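(* Let $X$ be a complex Banach space and let $F: X\to X^*$, $x\mapsto f_x$, be an isometric isomorphism (of $X$ onto $X^*$) that satisfies the following: (1) $f_x(y)=\overline{f_y(x)}$ for all $x,y\in X$; (2) for every $x\in X$, if $x\in\mathrm{Ker}(f_x)$ then $x=0$. Then $X$ is a Hilbert space with respect to the inner product given by $(x,y)=f_x(y)$, and $(x,x)=\|x\|^2$ for all $x\in X$.
   Context: $X^*$ denotes the space of continuous linear functionals on $X$ with the dual norm, and $f_x\in X^*$ denotes the image of $x$ under $F$. Isometric isomorphism of $X$ onto $X^*$ is understood in the conjugate-linear sense (as in the classical Riesz representation): a conjugate-linear bijection with $\|f_x\|=\|x\|$ for all $x$. Inner products are taken conjugate-linear in the first variable and linear in the second.
   Formalization: The sign of F is not determined by the hypotheses (f_x(y) = -conj(x)y on C satisfies them), so the conclusion is proved for (x,y)=f_x(y) or for (x,y)=-f_x(y), and for f_x(y) itself whenever f_x(x)>0 for some x. *)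

theory Defs
  imports "HOL-Analysis.Analysis"
begin

class complex_normed_vector = real_normed_vector +
  fixes scaleC :: "complex \<Rightarrow> 'a \<Rightarrow> 'a"  (infixr "*\<^sub>C" 75)
  assumes scaleC_add_right: "a *\<^sub>C (x + y) = a *\<^sub>C x + a *\<^sub>C y"
    and scaleC_add_left: "(a + b) *\<^sub>C x = a *\<^sub>C x + b *\<^sub>C x"
    and scaleC_scaleC: "a *\<^sub>C b *\<^sub>C x = (a * b) *\<^sub>C x"
    and scaleC_of_real: "complex_of_real r *\<^sub>C x = r *\<^sub>R x"
    and norm_scaleC: "norm (a *\<^sub>C x) = cmod a * norm x"

class complex_banach = complex_normed_vector + banach

instantiation complex :: complex_banach
begin

definition scaleC_complex :: "complex \<Rightarrow> complex \<Rightarrow> complex" where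
  "scaleC_complex a x = a * x"

instance
proof
  fix a b x y :: complex and r :: real
  show "a *\<^sub>C (x + y) = a *\<^sub>C x + a *\<^sub>C y"
    by (simp add: scaleC_complex_def distrib_left)
  show "(a + b) *\<^sub>C x = a *\<^sub>C x + b *\<^sub>C x"
    by (simp add: scaleC_complex_def distrib_right)
  show "a *\<^sub>C b *\<^sub>C x = (a * b) *\<^sub>C x"
    by (simp add: scaleC_complex_def mult.assoc)
  show "complex_of_real r *\<^sub>C x = r *\<^sub>R x"
    by (simp add: scaleC_complex_def scaleR_conv_of_real)
  show "norm (a *\<^sub>C x) = cmod a * norm x"
    by (simp add: scaleC_complex_def norm_mult)
qed

end

(* Elements of 'a \<Rightarrow>\<^sub>L complex are only real-linear a priori.  The norm of
   that type is the operator norm, i.e. the dual norm. *)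
definition complex_dual :: "('a::complex_normed_vector \<Rightarrow>\<^sub>L complex) set" where
  "complex_dual = {f. \<forall>c x. blinfun_apply f (c *\<^sub>C x) = c * blinfun_apply f x}"

(* The pointwise equation for F (c *\<^sub>C x) says that it is the functional
   (cnj c) F x; the type 'a \<Rightarrow>\<^sub>L complex carries no complex scalar multiplication. *)
definition conj_isometric_iso_dual ::
    "('a::complex_normed_vector \<Rightarrow> ('a \<Rightarrow>\<^sub>L complex)) \<Rightarrow> bool" where
  "conj_isometric_iso_dual F \<longleftrightarrow>
     (\<forall>x y. F (x + y) = F x + F y) \<and>
     (\<forall>c x y. blinfun_apply (F (c *\<^sub>C x)) y = cnj c * blinfun_apply (F x) y) \<and>
     bij_betw F UNIV complex_dual \<and>
     (\<forall>x. norm (F x) = norm x)"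

definition complex_inner_product ::
    "('a::complex_normed_vector \<Rightarrow> 'a \<Rightarrow> complex) \<Rightarrow> bool" where
  "complex_inner_product ip \<longleftrightarrow>
     (\<forall>x y z. ip x (y + z) = ip x y + ip x z) \<and>
     (\<forall>c x y. ip x (c *\<^sub>C y) = c * ip x y) \<and>
     (\<forall>x y. ip x y = cnj (ip y x)) \<and>
     (\<forall>x. ip x x \<in> \<real>\<^sub>\<ge>\<^sub>0) \<and>
     (\<forall>x. ip x x = 0 \<longrightarrow> x = 0)"

(* Completeness is for the metric induced by ip, not for the given norm of 'a. *)
definition hilbert_space_wrt ::
    "('a::complex_normed_vector \<Rightarrow> 'a \<Rightarrow> complex) \<Rightarrow> bool" where
  "hilbert_space_wrt ip \<longleftrightarrow>
     complex_inner_product ip \<and>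
     Metric_space.mcomplete UNIV (\<lambda>x y. sqrt (Re (ip (x - y) (x - y))))"

(* The hypotheses of the representation theorem do not fix the sign of F: they are
   invariant under replacing F by - F.  Already on the complex numbers they hold for
   f_x(y) = - cnj x * y, which is negative definite, so f_x(y) itself can be claimed to
   be an inner product only up to a global sign or after normalizing the sign. *)
lemma sign_not_determined:
  "\<exists>F :: complex \<Rightarrow> (complex \<Rightarrow>\<^sub>L complex).
     conj_isometric_iso_dual F \<and>
     (\<forall>x y. blinfun_apply (F x) y = cnj (blinfun_apply (F y) x)) \<and>
     (\<forall>x. blinfun_apply (F x) x = 0 \<longrightarrow> x = 0) \<and>
     \<not> complex_inner_product (\<lambda>x y. blinfun_apply (F x) y)"
proof -
  define F :: "complex \<Rightarrow> (complex \<Rightarrow>\<^sub>L complex)"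
    where "F = (\<lambda>x. blinfun_mult_right (- cnj x))"
  have ap: "blinfun_apply (F x) y = - cnj x * y" for x y
    by (simp add: F_def)
  have add: "F (x + y) = F x + F y" for x y
    by (rule blinfun_eqI) (simp add: ap plus_blinfun.rep_eq algebra_simps)
  have nrm: "norm (F x) = norm x" for x
  proof (rule antisym)
    show "norm (F x) \<le> norm x"
      by (rule norm_blinfun_bound) (auto simp: ap norm_mult)
    show "norm x \<le> norm (F x)"
      using norm_blinfun[of "F x" 1] by (simp add: ap)
  qed
  have "inj F"
  proof (rule injI)
    fix x y assume "F x = F y"
    then have "blinfun_apply (F x) 1 = blinfun_apply (F y) 1" by simp
    then show "x = y" by (simp add: ap)
  qed
  moreover have "range F = complex_dual"
  proof (intro set_eqI iffI)
    fix f assume "f \<in> range F"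
    then show "f \<in> complex_dual"
      by (auto simp: complex_dual_def ap scaleC_complex_def)
  next
    fix f :: "complex \<Rightarrow>\<^sub>L complex" assume f: "f \<in> complex_dual"
    have "blinfun_apply f y = y * blinfun_apply f 1" for y
    proof -
      have "blinfun_apply f (y *\<^sub>C 1) = y * blinfun_apply f 1"
        using f unfolding complex_dual_def by blast
      then show ?thesis by (simp add: scaleC_complex_def)
    qed
    then have "blinfun_apply f y = blinfun_apply (F (- cnj (blinfun_apply f 1))) y" for y
      unfolding ap by (metis complex_cnj_cnj complex_cnj_minus minus_minus mult.commute)
    then have "f = F (- cnj (blinfun_apply f 1))"
      by (rule blinfun_eqI)
    then show "f \<in> range F" by blast
  qed
  ultimately have "conj_isometric_iso_dual F"
    by (auto simp: conj_isometric_iso_dual_def bij_betw_def add nrm ap scaleC_complex_def)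
  moreover have "\<not> complex_inner_product (\<lambda>x y. blinfun_apply (F x) y)"
  proof
    assume "complex_inner_product (\<lambda>x y. blinfun_apply (F x) y)"
    then have "blinfun_apply (F 1) 1 \<in> \<real>\<^sub>\<ge>\<^sub>0"
      unfolding complex_inner_product_def by blast
    then show False by (simp add: ap complex_nonneg_Reals_iff)
  qed
  ultimately show ?thesis
    by (intro exI[of _ F]) (auto simp: ap)
qed

end

theory Submission
  imports Defs "HOL-Library.Quadratic_Discriminant"
begin

text \<open>
  On a real line joining a vector of positive square to one of negative square, the quadratic form
  \<open>Re (f\<^sub>x x)\<close> has a zero; as there are no isotropic vectors, the form is definite.
  Suppose it is positive and write \<open>q x = sqrt (f\<^sub>x x)\<close>. Then \<open>q x \<le> norm x\<close> because
  \<open>norm f\<^sub>x = norm x\<close>. Conversely \<open>cmod (f\<^sub>x y) \<le> q x * q y \<le> q x * norm y\<close> by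
  Cauchy--Schwarz, so \<open>norm x = norm f\<^sub>x \<le> q x\<close>. Hence \<open>q\<close> is the given complete norm.
\<close>

lemma bilinear_quadratic_expand:
  fixes b :: "'a::real_vector \<Rightarrow> 'a \<Rightarrow> real"
  assumes "bilinear b" and "\<And>x y. b x y = b y x"
  shows "b (x + t *\<^sub>R y) (x + t *\<^sub>R y) = b x x + 2 * t * b x y + t\<^sup>2 * b y y"
  using assms(2)[of x y]
  by (simp add: bilinear_ladd[OF assms(1)] bilinear_radd[OF assms(1)] bilinear_lmul[OF assms(1)]
      bilinear_rmul[OF assms(1)] power2_eq_square algebra_simps)

lemma anisotropic_bilinear_nonneg:
  fixes b :: "'a::real_vector \<Rightarrow> 'a \<Rightarrow> real"
  assumes bil: "bilinear b" and sym: "\<And>x y. b x y = b y x"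
    and aniso: "\<And>x. b x x = 0 \<Longrightarrow> x = 0"
    and pos: "b x x > 0"
  shows "b y y \<ge> 0"
proof (rule ccontr)
  assume "\<not> b y y \<ge> 0"
  then have neg: "b y y < 0" by simp
  \<comment> \<open>As a polynomial in \<open>t\<close>, the square of
    \<open>x + t *\<^sub>R y\<close> has leading coefficient \<open>b y y\<close> and constant term
    \<open>b x x\<close>. These have opposite signs, so the discriminant is nonnegative and there is
    a real root.\<close>
  have "discrim (b y y) (2 * b x y) (b x x) \<ge> 0"
    using order_trans[OF less_imp_le[OF mult_neg_pos[OF neg pos]] zero_le_power2[of "b x y"]]
    by (simp add: discrim_def power_mult_distrib)
  then obtain t where "b y y * t\<^sup>2 + 2 * b x y * t + b x x = 0"
    using neg discriminant_nonneg_ex by (metis less_irrefl)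
  then have "b (x + t *\<^sub>R y) (x + t *\<^sub>R y) = 0"
    by (simp add: bilinear_quadratic_expand[OF bil sym] algebra_simps)
  \<comment> \<open>At the root the vector is isotropic, hence zero. So \<open>x\<close> is a real
    multiple of \<open>y\<close>, and its square cannot be positive when that of \<open>y\<close> is
    negative.\<close>
  then have "x = (- t) *\<^sub>R y"
    using aniso by (simp add: eq_neg_iff_add_eq_0)
  then have "b x x = t * t * b y y"
    by (simp add: bilinear_lmul[OF bil] bilinear_rmul[OF bil] bilinear_lneg[OF bil]
        bilinear_rneg[OF bil])
  then show False
    using mult_nonneg_nonpos[of "t * t" "b y y"] neg pos by simp
qed

lemma bilinear_Cauchy_Schwarz:
  fixes b :: "'a::real_vector \<Rightarrow> 'a \<Rightarrow> real"
  assumes bil: "bilinear b" and sym: "\<And>x y. b x y = b y x"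
    and aniso: "\<And>x. b x x = 0 \<Longrightarrow> x = 0"
    and nonneg: "\<And>x. b x x \<ge> 0"
  shows "(b x y)\<^sup>2 \<le> b x x * b y y"
proof (cases "b y y = 0")
  case True
  then show ?thesis
    using aniso[of y] bilinear_rzero[OF bil] by simp
next
  case False
  then have pos: "b y y > 0"
    using nonneg[of y] by simp
  \<comment> \<open>The coefficient \<open>- b x y / b y y\<close> minimises the square of
    \<open>x + t *\<^sub>R y\<close> over real \<open>t\<close>.\<close>
  have "0 \<le> b x x + 2 * (- b x y / b y y) * b x y + (- b x y / b y y)\<^sup>2 * b y y"
    using nonneg[of "x + (- b x y / b y y) *\<^sub>R y"]
    by (simp only: bilinear_quadratic_expand[OF bil sym])
  also have "\<dots> = b x x - (b x y)\<^sup>2 / b y y"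
    using pos by (simp add: field_simps power2_eq_square)
  finally show ?thesis
    using pos by (simp add: field_simps)
qed

text \<open>Conjugation preserves real parts, so hermitian symmetry carries real linearity from the
  second argument over to the first.\<close>

lemma bilinear_Re_hermitian:
  fixes F :: "'a::complex_normed_vector \<Rightarrow> ('a \<Rightarrow>\<^sub>L complex)"
  assumes herm: "\<And>x y. F x y = cnj (F y x)"
  shows "bilinear (\<lambda>x y. Re (F x y))"
proof -
  have r: "linear (\<lambda>y. Re (F x y))" for x
    by (rule linearI) (simp_all add: blinfun.add_right blinfun.scaleR_right)
  moreover have "(\<lambda>x. Re (F x y)) = (\<lambda>x. Re (F y x))" for y
    by (rule ext) (subst herm, simp)
  ultimately show ?thesis
    unfolding bilinear_def by metis
qed

text \<open>Semidefiniteness is a hypothesis here so that the result can be applied to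
  \<open>F\<close> as well as to \<open>- F\<close>.\<close>

lemma hilbert_space_of_positive_form:
  fixes F :: "'a::complex_banach \<Rightarrow> ('a \<Rightarrow>\<^sub>L complex)"
  assumes dual: "\<And>x. F x \<in> complex_dual"
    and herm: "\<And>x y. F x y = cnj (F y x)"
    and aniso: "\<And>x. F x x = 0 \<Longrightarrow> x = 0"
    and iso: "\<And>x. norm (F x) = norm x"
    and nonneg: "\<And>x. Re (F x x) \<ge> 0"
  shows "hilbert_space_wrt (\<lambda>x y. F x y)" and "\<And>x. F x x = complex_of_real ((norm x)\<^sup>2)"
proof -
  define b where "b = (\<lambda>x y. Re (F x y))"
  have hom: "F x (c *\<^sub>C y) = c * F x y" for x c y
    using dual by (simp add: complex_dual_def)
  have diag: "F x x = complex_of_real (b x x)" for x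
    using arg_cong[OF herm[of x x], of Im] by (simp add: b_def complex_eq_iff)
  have b: "bilinear b"
    unfolding b_def using herm by (rule bilinear_Re_hermitian)
  have sym: "b x y = b y x" for x y
    using herm[of x y] by (simp add: b_def)
  have CS: "(b x y)\<^sup>2 \<le> b x x * b y y" for x y
    using b sym
  proof (rule bilinear_Cauchy_Schwarz)
    show "b x x = 0 \<Longrightarrow> x = 0" for x
      using aniso[of x] diag[of x] by simp
    show "b x x \<ge> 0" for x
      using nonneg by (simp add: b_def)
  qed
  have le: "b x x \<le> (norm x)\<^sup>2" for x
  proof -
    have "b x x \<le> cmod (F x x)"
      unfolding b_def by (rule complex_Re_le_cmod)
    also have "\<dots> \<le> norm (F x) * norm x"
      by (rule norm_blinfun)
    finally show ?thesis
      by (simp add: iso power2_eq_square)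
  qed
  have bnn: "b x x \<ge> 0" for x
    using nonneg by (simp add: b_def)
  have "norm (F x) \<le> sqrt (b x x)" for x
  proof (rule norm_blinfun_bound)
    fix y
    \<comment> \<open>Multiplying by \<open>c\<close> rotates \<open>F x y\<close> onto the
      nonnegative real axis, so that Cauchy-Schwarz for the real form \<open>b\<close> bounds the
      complex modulus. Since \<open>sgn 0 = 0\<close>, the norm of \<open>c\<close> is 1 or 0, which
      is why only an inequality for \<open>norm (c *\<^sub>C y)\<close> follows.\<close>
    define c where "c = cnj (sgn (F x y))"
    have "F x (c *\<^sub>C y) = complex_of_real (cmod (F x y))"
      by (cases "F x y = 0")
        (simp_all add: hom c_def sgn_eq complex_norm_square[symmetric] power2_eq_square field_simps)
    then have "(cmod (F x y))\<^sup>2 = (b x (c *\<^sub>C y))\<^sup>2"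
      by (simp add: b_def)
    also have "\<dots> \<le> b x x * (norm (c *\<^sub>C y))\<^sup>2"
      using CS[of x "c *\<^sub>C y"] mult_left_mono[OF le bnn] by (rule order_trans)
    also have "norm (c *\<^sub>C y) \<le> norm y"
      by (simp add: norm_scaleC c_def norm_sgn)
    then have "b x x * (norm (c *\<^sub>C y))\<^sup>2 \<le> b x x * (norm y)\<^sup>2"
      using bnn by (intro mult_left_mono power_mono) auto
    also have "\<dots> = (sqrt (b x x) * norm y)\<^sup>2"
      using bnn by (simp add: power_mult_distrib)
    finally show "cmod (F x y) \<le> sqrt (b x x) * norm y"
      using bnn by (auto intro: power2_le_imp_le)
  qed (simp add: bnn)
  then have "(norm x)\<^sup>2 \<le> b x x" for x
    using iso[of x] bnn[of x] by (metis norm_ge_zero power_mono real_sqrt_pow2)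
  with le have norm: "b x x = (norm x)\<^sup>2" for x
    by (simp add: antisym)
  show diag_norm: "F x x = complex_of_real ((norm x)\<^sup>2)" for x
    using diag norm by simp
  have "complex_inner_product (\<lambda>x y. F x y)"
    unfolding complex_inner_product_def
  proof (intro conjI allI)
    show "F x y = cnj (F y x)" for x y
      by (rule herm)
  qed (simp_all add: hom diag_norm blinfun.add_right complex_nonneg_Reals_iff)
  \<comment> \<open>The induced metric is the original one, so completeness is that of the Banach
    space.\<close>
  moreover have "(\<lambda>x y. sqrt (Re (F (x - y) (x - y)))) = dist"
    by (simp add: diag_norm dist_norm fun_eq_iff)
  moreover have "Metric_space.mcomplete UNIV (dist :: 'a \<Rightarrow> 'a \<Rightarrow> real)"
    by (simp add: mcomplete_iff_complete complete_UNIV)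
  ultimately show "hilbert_space_wrt (\<lambda>x y. F x y)"
    by (simp add: hilbert_space_wrt_def)
qed

theorem theorem4:
  fixes F :: "'a::complex_banach \<Rightarrow> ('a \<Rightarrow>\<^sub>L complex)"
  assumes "conj_isometric_iso_dual F"
    and "\<forall>x y. blinfun_apply (F x) y = cnj (blinfun_apply (F y) x)"
    and "\<forall>x. blinfun_apply (F x) x = 0 \<longrightarrow> x = 0"
  shows
    "((hilbert_space_wrt (\<lambda>x y. blinfun_apply (F x) y) \<and>
       (\<forall>x. blinfun_apply (F x) x = complex_of_real ((norm x)\<^sup>2))) \<or>
      (hilbert_space_wrt (\<lambda>x y. - blinfun_apply (F x) y) \<and>
       (\<forall>x. - blinfun_apply (F x) x = complex_of_real ((norm x)\<^sup>2)))) \<and>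
     ((\<exists>x. Re (blinfun_apply (F x) x) > 0) \<longrightarrow>
       hilbert_space_wrt (\<lambda>x y. blinfun_apply (F x) y) \<and>
       (\<forall>x. blinfun_apply (F x) x = complex_of_real ((norm x)\<^sup>2)))"
proof -
  have dual: "F x \<in> complex_dual" and iso: "norm (F x) = norm x" for x
    using assms(1) by (auto simp: conj_isometric_iso_dual_def bij_betw_def)
  have herm: "F x y = cnj (F y x)" for x y
    using assms(2) by blast
  have aniso: "F x x = 0 \<Longrightarrow> x = 0" for x
    using assms(3) by blast
  have pos: "hilbert_space_wrt (\<lambda>x y. F x y) \<and> (\<forall>x. F x x = complex_of_real ((norm x)\<^sup>2))"
    if "Re (F z z) > 0" for z
  proof -
    have "Re (F x x) \<ge> 0" for x
      using bilinear_Re_hermitian[OF herm] _ _ that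
    proof (rule anisotropic_bilinear_nonneg)
      show "Re (F x y) = Re (F y x)" for x y
        using herm[of x y] by simp
      \<comment> \<open>Hermitian symmetry makes \<open>F x x\<close> real, so a vanishing real part
        already gives \<open>F x x = 0\<close>.\<close>
      show "x = 0" if "Re (F x x) = 0" for x
        using that arg_cong[OF herm[of x x], of Im] by (intro aniso) (simp add: complex_eq_iff)
    qed
    then show ?thesis
      using hilbert_space_of_positive_form[OF dual herm aniso iso] by blast
  qed
  \<comment> \<open>Without a vector of positive square, the positive case applies to
    \<open>- F\<close>; this includes the zero space.\<close>
  have neg: "hilbert_space_wrt (\<lambda>x y. - F x y) \<and> (\<forall>x. - F x x = complex_of_real ((norm x)\<^sup>2))"
    if "\<And>x. Re (F x x) \<le> 0"
  proof -
    have "- F x \<in> complex_dual" for x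
      using dual[of x] by (simp add: complex_dual_def blinfun.minus_left)
    moreover have "(- F x) y = cnj ((- F y) x)" for x y
      using herm[of x y] by (simp add: blinfun.minus_left)
    moreover have "(- F x) x = 0 \<Longrightarrow> x = 0" for x
      using aniso[of x] by (simp add: blinfun.minus_left)
    moreover have "norm (- F x) = norm x" and "Re ((- F x) x) \<ge> 0" for x
      using iso that by (simp_all add: blinfun.minus_left)
    ultimately have "hilbert_space_wrt (\<lambda>x y. (- F x) y)"
        and "(- F x) x = complex_of_real ((norm x)\<^sup>2)" for x
      by (fact hilbert_space_of_positive_form)+
    then show ?thesis
      by (simp add: blinfun.minus_left)
  qed
  show ?thesis
    using pos neg by (meson not_le)
qed

end
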